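(* Let $K$ be a field, let $S=K[x_1,\dots,x_n]$, and let $I$ be a $3$-generated squarefree monomial ideal in $S$, i.e. $I=(v_1,v_2,v_3)$ for squarefree monomials $v_1,v_2,v_3\in S$. Then $\operatorname{sdepth}(I)\ge n-1$. In particular, if $I$ is not principal, then $\operatorname{sdepth}(I)=n-1$.
   Context: $S=K[x_1,\dots,x_n]$ is the polynomial ring in $n$ variables over the field $K$, with its standard $\mathbb{Z}^n$-grading. A monomial is squarefree if no variable occurs in it with exponent larger than $1$. The three generators are not required to be a minimal generating set. Stanley depth: for a monomial $u\in I$ and a subset $Z\subseteq\{x_1,\dots,x_n\}$, the $K$-subspace $uK[Z]$ of $I$ (spanned by all $uw$ with $w$ a monomial in the variables of $Z$) is called a Stanley space. A Stanley decomposition of $I$ is a finite direct sum decomposition $\mathcal{D}: I=\bigoplus_{i=1}^r u_iK[Z_i]$ of $I$ as a $\mathbb{Z}^n$-graded $K$-vector space into Stanley spaces (i.e. every monomial of $I$ lies in exactly one $u_iK[Z_i]$). Its Stanley depth is $\operatorname{sdepth}(\mathcal{D})=\min\{|Z_i| : 1\le i\le r\}$, and $\operatorname{sdepth}(I)$ is the maximum of $\operatorname{sdepth}(\mathcal{D})$ over all Stanley decompositions $\mathcal{D}$ of $I$. *)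

theory Defs
  imports Complex_Main "HOL-Library.Cardinality" "HOL-Library.Poly_Mapping" "HOL-Library.FuncSet"
begin

(* The polynomial ring S = K[x_i | i :: 'n] over 'k, in CARD('n) variables. An element is the
   finitely supported map from exponent vectors to coefficients; its ring structure is the
   convolution product of HOL-Library.Poly_Mapping. *)
type_synonym ('n, 'k) mpolys = "('n \<Rightarrow>\<^sub>0 nat) \<Rightarrow>\<^sub>0 'k"

definition mon :: "('n \<Rightarrow>\<^sub>0 nat) \<Rightarrow> ('n, 'k::comm_ring_1) mpolys" where
  "mon t = Poly_Mapping.single t 1"

definition squarefree_monomial :: "('n, 'k::comm_ring_1) mpolys \<Rightarrow> bool" where
  "squarefree_monomial v \<longleftrightarrow> (\<exists>t. v = mon t \<and> (\<forall>i. Poly_Mapping.lookup t i \<le> 1))"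

(* An ideal is a submodule of the ring over itself. *)
definition ideal_gen :: "'a::comm_ring_1 set \<Rightarrow> 'a set" where
  "ideal_gen B = module.span (*) B"

definition principal_ideal :: "'a::comm_ring_1 set \<Rightarrow> bool" where
  "principal_ideal I \<longleftrightarrow> (\<exists>p. I = ideal_gen {p})"

definition scalar_mult :: "'k::comm_ring_1 \<Rightarrow> ('n, 'k) mpolys \<Rightarrow> ('n, 'k) mpolys" where
  "scalar_mult c p = Poly_Mapping.map ((*) c) p"

(* module.span is an unconditional constant, but its laws need these locale predicates. *)
lemma module_times: "module ((*) :: 'a::comm_ring_1 \<Rightarrow> 'a \<Rightarrow> 'a)"
  by (unfold_locales) (simp_all add: algebra_simps)

lemma vector_space_scalar_mult:
  "vector_space (scalar_mult :: 'k::field \<Rightarrow> ('n, 'k) mpolys \<Rightarrow> ('n, 'k) mpolys)"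
  unfolding scalar_mult_def
  by unfold_locales
    (simp_all add: mult_map_scale_conv_mult algebra_simps single_add mult_single
      flip: mult.assoc)

(* The Stanley space u K[Z], where u is given by its exponent vector. *)
definition stanley_space ::
    "('n \<Rightarrow>\<^sub>0 nat) \<Rightarrow> 'n set \<Rightarrow> ('n, 'k::field) mpolys set" where
  "stanley_space u Z =
     module.span scalar_mult {mon u * mon w | w. Poly_Mapping.keys w \<subseteq> Z}"

(* W is the internal direct sum of the V i: every sum of elements of the V i lies in W, and every
   element of W is such a sum in exactly one way. *)
definition is_direct_sum ::
    "'i set \<Rightarrow> ('i \<Rightarrow> 'a::comm_monoid_add set) \<Rightarrow> 'a set \<Rightarrow> bool" where
  "is_direct_sum A V W \<longleftrightarrow> bij_betw (\<lambda>g. \<Sum>i\<in>A. g i) (\<Pi>\<^sub>E i\<in>A. V i) W"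

(* A set of pairs (u, Z), rather than an indexed family, loses nothing: Stanley spaces are nonzero,
   so no pair can occur twice in a direct sum. Compatibility with the grading by exponent vectors
   is automatic, as each u K[Z] is spanned by monomials. *)
definition stanley_decomposition ::
    "('n, 'k::field) mpolys set \<Rightarrow> (('n \<Rightarrow>\<^sub>0 nat) \<times> 'n set) set \<Rightarrow> bool" where
  "stanley_decomposition I D \<longleftrightarrow>
     finite D \<and> (\<forall>(u, Z)\<in>D. mon u \<in> I) \<and> is_direct_sum D (\<lambda>(u, Z). stanley_space u Z) I"

(* Meaningful for nonempty D, i.e. for decompositions of nonzero ideals. *)
definition sdepth_decomp :: "(('n \<Rightarrow>\<^sub>0 nat) \<times> 'n set) set \<Rightarrow> nat" where
  "sdepth_decomp D = Min ((\<lambda>(u, Z). card Z) ` D)"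

(* For finite 'n the values range over a finite set, so Max is the maximum as soon as some
   decomposition exists. *)
definition sdepth :: "('n::finite, 'k::field) mpolys set \<Rightarrow> nat" where
  "sdepth I = Max {sdepth_decomp D | D. stanley_decomposition I D}"

end

theory Submission
  imports Defs "HOL-Library.Disjoint_Sets"
begin

text \<open>
  The lower bound rests on a cyclic way of sorting the monomials of \<open>(a, b, c)\<close>. Such a monomial
  is divisible by at least one of the generators. If it is divisible by all three, it is a
  multiple of their lcm, and these multiples form a single Stanley space of dimension \<open>n\<close>.
  Otherwise, in the cyclic order \<open>a, c, b\<close>, there is exactly one place where a generator that
  divides the monomial is followed by one that does not: among three positions on a circle, the
  divisors form one unbroken arc. Hence the monomials of \<open>(a, b, c)\<close> are the disjoint union of
  the multiples of the lcm and of three differences of principal ideals, ``divisible by \<open>a\<close> but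
  not by \<open>c\<close>'', ``by \<open>b\<close> but not by \<open>a\<close>'', ``by \<open>c\<close> but not by \<open>b\<close>''.

  A difference ``divisible by \<open>w\<close> but not by \<open>u\<close>'' always splits into Stanley spaces of dimension
  \<open>n - 1\<close>: sort its monomials by the first
  variable \<open>x\<^sub>j\<close>, in some fixed order of the variables, whose exponent is smaller than in \<open>u\<close>, and
  by the value of that exponent. Each class prescribes the exponent of \<open>x\<^sub>j\<close> and bounds all the
  others from below (lemma \<open>splits_into_cones_not_all_above\<close>).

  For the upper bound, two Stanley spaces \<open>u S\<close> and \<open>u' S\<close> of full dimension share the monomial
  \<open>u u'\<close>. A decomposition into spaces of dimension \<open>n\<close> therefore has only one summand, and the
  ideal is principal.

  Everything above concerns sets of exponent vectors. The bridge to the algebra is that the ideals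
  and Stanley spaces in question consist of all polynomials whose monomials lie in a given set,
  and that such subspaces form a direct sum exactly when the sets form a partition
  (lemma \<open>is_direct_sum_monomial_span_iff\<close>).
\<close>

section \<open>Subspaces spanned by monomials\<close>

abbreviation lookup :: "('a \<Rightarrow>\<^sub>0 'b::zero) \<Rightarrow> 'a \<Rightarrow> 'b" where
  "lookup \<equiv> Poly_Mapping.lookup"

definition monomial_span :: "('n \<Rightarrow>\<^sub>0 nat) set \<Rightarrow> ('n, 'k::zero) mpolys set" where
  "monomial_span M = {p. Poly_Mapping.keys p \<subseteq> M}"

text \<open>
  The exponents of the monomials in a Stanley space. The order is the pointwise one of functions,
  that is, divisibility of monomials; the order that the type of finitely supported maps itself
  carries is lexicographic.
\<close>

definition cone :: "('n \<Rightarrow>\<^sub>0 nat) \<Rightarrow> 'n set \<Rightarrow> ('n \<Rightarrow>\<^sub>0 nat) set" where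
  "cone u Z = {t. lookup u \<le> lookup t \<and> (\<forall>i. i \<notin> Z \<longrightarrow> lookup t i = lookup u i)}"

lemma cone_UNIV: "cone u UNIV = {t. lookup u \<le> lookup t}"
  by (simp add: cone_def)

lemma add_diff_exponent:
  fixes u t :: "'n \<Rightarrow>\<^sub>0 nat"
  assumes "lookup u \<le> lookup t"
  shows "u + (t - u) = t"
  using assms by (intro poly_mapping_eqI) (simp add: lookup_add lookup_minus le_fun_def)

lemma mon_mult: "mon u * mon w = mon (u + w)"
  by (simp add: mon_def mult_single)

lemma mon_in_monomial_span: "(mon t :: ('n, 'k::field) mpolys) \<in> monomial_span M \<longleftrightarrow> t \<in> M"
  by (simp add: monomial_span_def mon_def)

lemma poly_mapping_as_sum:
  fixes p :: "'a \<Rightarrow>\<^sub>0 'b::comm_monoid_add"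
  shows "p = (\<Sum>t\<in>Poly_Mapping.keys p. Poly_Mapping.single t (lookup p t))"
  by (rule poly_mapping_eqI) (auto simp: lookup_sum lookup_single when_def in_keys_iff)

lemma lookup_scalar_mult: "lookup (scalar_mult c p) t = c * lookup p t"
  by (simp add: scalar_mult_def map.rep_eq when_def)

lemma scalar_mult_mon: "scalar_mult c (mon t) = Poly_Mapping.single t c"
  by (rule poly_mapping_eqI) (simp add: lookup_scalar_mult mon_def lookup_single when_def)

lemma stanley_space_eq_monomial_span:
  "(stanley_space u Z :: ('n, 'k::field) mpolys set) = monomial_span (cone u Z)"
proof -
  interpret vector_space "scalar_mult :: 'k \<Rightarrow> ('n, 'k) mpolys \<Rightarrow> _"
    by (rule vector_space_scalar_mult)
  let ?G = "{mon u * mon w | w. Poly_Mapping.keys w \<subseteq> Z} :: ('n, 'k) mpolys set"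
  have "span ?G = monomial_span (cone u Z)"
  proof
    have "subspace (monomial_span (cone u Z) :: ('n, 'k) mpolys set)"
    proof (rule subspaceI)
      fix x y :: "('n, 'k) mpolys"
      assume "x \<in> monomial_span (cone u Z)" "y \<in> monomial_span (cone u Z)"
      then show "x + y \<in> monomial_span (cone u Z)"
        using keys_add[of x y] by (auto simp: monomial_span_def)
    qed (auto simp: monomial_span_def in_keys_iff lookup_scalar_mult)
    moreover have "?G \<subseteq> monomial_span (cone u Z)"
      by (auto simp: mon_mult mon_in_monomial_span cone_def lookup_add le_fun_def
          simp flip: not_in_keys_iff_lookup_eq_zero)
    ultimately show "span ?G \<subseteq> monomial_span (cone u Z)"
      by (rule span_minimal[rotated])
  next
    show "monomial_span (cone u Z) \<subseteq> span ?G"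
    proof
      fix p :: "('n, 'k) mpolys"
      assume p: "p \<in> monomial_span (cone u Z)"
      have "Poly_Mapping.single t (lookup p t) \<in> span ?G" if "t \<in> Poly_Mapping.keys p" for t
      proof -
        have t: "t \<in> cone u Z" using p that by (auto simp: monomial_span_def)
        then have "Poly_Mapping.keys (t - u) \<subseteq> Z"
          by (auto simp: cone_def in_keys_iff lookup_minus)
        moreover have "mon t = mon u * (mon (t - u) :: ('n, 'k) mpolys)"
          using t by (simp add: mon_mult cone_def add_diff_exponent)
        ultimately have "mon t \<in> ?G" by blast
        then show ?thesis
          unfolding scalar_mult_mon[symmetric] by (intro span_scale span_base)
      qed
      then show "p \<in> span ?G"
        by (subst poly_mapping_as_sum) (rule span_sum)
    qed
  qed
  then show ?thesis by (simp add: stanley_space_def)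
qed

lemma ideal_gen_mon_image:
  "ideal_gen (mon ` G :: ('n, 'k::field) mpolys set)
    = monomial_span {t. \<exists>g\<in>G. lookup g \<le> lookup t}"
proof -
  interpret module "(*) :: ('n, 'k) mpolys \<Rightarrow> _ \<Rightarrow> _"
    by (rule module_times)
  let ?M = "{t. \<exists>g\<in>G. lookup g \<le> lookup t}"
  have "span (mon ` G) = (monomial_span ?M :: ('n, 'k) mpolys set)"
  proof
    have "subspace (monomial_span ?M :: ('n, 'k) mpolys set)"
    proof (rule subspaceI)
      fix x y :: "('n, 'k) mpolys"
      assume "x \<in> monomial_span ?M" "y \<in> monomial_span ?M"
      then show "x + y \<in> monomial_span ?M"
        using keys_add[of x y] by (fastforce simp: monomial_span_def)
    next
      fix c x :: "('n, 'k) mpolys"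
      assume x: "x \<in> monomial_span ?M"
      have "t \<in> ?M" if "t \<in> Poly_Mapping.keys (c * x)" for t
      proof -
        obtain a b where ab: "t = a + b" "b \<in> Poly_Mapping.keys x"
          using keys_mult[of c x] \<open>t \<in> _\<close> by blast
        then obtain g where "g \<in> G" "lookup g \<le> lookup b"
          using x by (auto simp: monomial_span_def)
        then show ?thesis
          using ab(1) by (auto simp: lookup_add le_fun_def intro!: bexI[of _ g] trans_le_add2)
      qed
      then show "c * x \<in> monomial_span ?M"
        by (auto simp: monomial_span_def)
    qed (simp add: monomial_span_def)
    moreover have "mon ` G \<subseteq> (monomial_span ?M :: ('n, 'k) mpolys set)"
      by (auto simp: mon_in_monomial_span)
    ultimately show "span (mon ` G) \<subseteq> (monomial_span ?M :: ('n, 'k) mpolys set)"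
      by (rule span_minimal[rotated])
  next
    show "(monomial_span ?M :: ('n, 'k) mpolys set) \<subseteq> span (mon ` G)"
    proof
      fix p :: "('n, 'k) mpolys"
      assume p: "p \<in> monomial_span ?M"
      have "Poly_Mapping.single t (lookup p t) \<in> span (mon ` G)" if t: "t \<in> Poly_Mapping.keys p" for t
      proof -
        obtain g where g: "g \<in> G" "lookup g \<le> lookup t"
          using p t by (auto simp: monomial_span_def)
        have "Poly_Mapping.single t (lookup p t)
            = Poly_Mapping.single (t - g) (lookup p t) * (mon g :: ('n, 'k) mpolys)"
          using add_diff_exponent[OF g(2)] by (simp add: mon_def mult_single add.commute)
        then show ?thesis
          using span_scale[OF span_base[OF imageI[OF g(1)]]] by metis
      qed
      then show "p \<in> span (mon ` G)"
        by (subst poly_mapping_as_sum) (rule span_sum)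
    qed
  qed
  then show ?thesis by (simp add: ideal_gen_def)
qed

text \<open>
  The monomials are a basis, so a point in two of the sets would give a monomial with two
  representations, and a point of \<open>M\<close> outside all of them a monomial with none. Conversely, if the
  sets partition \<open>M\<close>, the component of a polynomial in the \<open>i\<close>-th summand can only be its restriction
  to \<open>C i\<close>.
\<close>

lemma is_direct_sum_monomial_span_iff:
  fixes C :: "'i \<Rightarrow> ('n \<Rightarrow>\<^sub>0 nat) set"
  assumes "finite D"
  shows "is_direct_sum D (\<lambda>i. monomial_span (C i) :: ('n, 'k::field) mpolys set) (monomial_span M)
    \<longleftrightarrow> disjoint_family_on C D \<and> (\<Union>i\<in>D. C i) = M"
proof (intro iffI conjI)
  let ?P = "\<Pi>\<^sub>E i\<in>D. (monomial_span (C i) :: ('n, 'k) mpolys set)"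
  assume "is_direct_sum D (\<lambda>i. monomial_span (C i) :: ('n, 'k) mpolys set) (monomial_span M)"
  then have inj: "inj_on (\<lambda>g. \<Sum>i\<in>D. g i) ?P"
    and img: "(\<lambda>g. \<Sum>i\<in>D. g i) ` ?P = monomial_span M"
    by (auto simp: is_direct_sum_def bij_betw_def)
  \<comment> \<open>the family that represents the monomial \<open>t\<close> by itself, placed in the \<open>i\<close>-th summand\<close>
  define e where "e t i = (\<lambda>x\<in>D. if x = i then mon t else 0 :: ('n, 'k) mpolys)" for t i
  have e: "e t i \<in> ?P" "(\<Sum>x\<in>D. e t i x) = mon t" if "i \<in> D" "t \<in> C i" for t i
  proof -
    show "e t i \<in> ?P"
      using that by (auto simp: e_def mon_in_monomial_span) (simp add: monomial_span_def)
    have "(\<Sum>x\<in>D. e t i x) = (\<Sum>x\<in>D. if x = i then mon t else 0)"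
      by (rule sum.cong) (auto simp: e_def)
    then show "(\<Sum>x\<in>D. e t i x) = mon t"
      using that assms by simp
  qed
  show "disjoint_family_on C D"
    unfolding disjoint_family_on_def
  proof (intro ballI impI, rule ccontr)
    fix i j assume ij: "i \<in> D" "j \<in> D" "i \<noteq> j" "C i \<inter> C j \<noteq> {}"
    then obtain t where "t \<in> C i" "t \<in> C j" by blast
    then have "e t i = e t j"
      using ij e[of i t] e[of j t] by (intro inj_onD[OF inj]) auto
    then have "e t i i = e t j i" by simp
    then have "lookup (e t i i) t = lookup (e t j i) t" by simp
    then show False
      using ij by (simp add: e_def mon_def)
  qed
  show "(\<Union>i\<in>D. C i) = M"
  proof
    show "(\<Union>i\<in>D. C i) \<subseteq> M"
    proof
      fix t assume "t \<in> (\<Union>i\<in>D. C i)"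
      then obtain i where "i \<in> D" "t \<in> C i" by blast
      then have "(mon t :: ('n, 'k) mpolys) \<in> monomial_span M"
        unfolding img[symmetric] using e[of i t] by (intro image_eqI[of _ _ "e t i"]) auto
      then show "t \<in> M" by (simp add: mon_in_monomial_span)
    qed
    show "M \<subseteq> (\<Union>i\<in>D. C i)"
    proof
      fix t assume "t \<in> M"
      then have "(mon t :: ('n, 'k) mpolys) \<in> monomial_span M"
        by (simp add: mon_in_monomial_span)
      then obtain g where g: "g \<in> ?P" "mon t = (\<Sum>i\<in>D. g i)"
        unfolding img[symmetric] by blast
      have "(\<Sum>i\<in>D. lookup (g i) t) = lookup (mon t :: ('n, 'k) mpolys) t"
        by (simp add: g(2) lookup_sum)
      also have "\<dots> \<noteq> 0" by (simp add: mon_def)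
      finally obtain i where "i \<in> D" "lookup (g i) t \<noteq> 0"
        by (meson sum.not_neutral_contains_not_neutral)
      then show "t \<in> (\<Union>i\<in>D. C i)"
        using g(1) by (fastforce simp: monomial_span_def in_keys_iff)
    qed
  qed
next
  let ?P = "\<Pi>\<^sub>E i\<in>D. (monomial_span (C i) :: ('n, 'k) mpolys set)"
  assume *: "disjoint_family_on C D \<and> (\<Union>i\<in>D. C i) = M"
  have sum_lookup: "lookup (\<Sum>j\<in>D. g j) t = lookup (g i) t"
    if g: "g \<in> ?P" and i: "i \<in> D" "t \<in> C i" for g i t
  proof -
    have "lookup (g j) t = 0" if "j \<in> D - {i}" for j
    proof -
      have "t \<notin> C j" using * i that by (auto simp: disjoint_family_on_def)
      then show ?thesis using g that by (fastforce simp: monomial_span_def in_keys_iff)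
    qed
    then have "(\<Sum>j\<in>D. lookup (g j) t) = lookup (g i) t"
      using assms i by (simp add: sum.remove)
    then show ?thesis by (simp add: lookup_sum)
  qed
  show "is_direct_sum D (\<lambda>i. monomial_span (C i) :: ('n, 'k) mpolys set) (monomial_span M)"
    unfolding is_direct_sum_def bij_betw_def
  proof
    show "inj_on (\<lambda>g. \<Sum>i\<in>D. g i) ?P"
    proof (rule inj_onI)
      fix g h assume gh: "g \<in> ?P" "h \<in> ?P" "(\<Sum>i\<in>D. g i) = (\<Sum>i\<in>D. h i)"
      have "g i = h i" if "i \<in> D" for i
      proof (rule poly_mapping_eqI)
        fix t
        show "lookup (g i) t = lookup (h i) t"
        proof (cases "t \<in> C i")
          case True
          then show ?thesis
            using sum_lookup[OF gh(1) that] sum_lookup[OF gh(2) that] gh(3) by metis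
        next
          case False
          then have "t \<notin> Poly_Mapping.keys (g i)" "t \<notin> Poly_Mapping.keys (h i)"
            using gh that by (auto simp: monomial_span_def PiE_iff)
          then show ?thesis by (simp add: in_keys_iff)
        qed
      qed
      then show "g = h" using gh by (intro PiE_ext) auto
    qed
    show "(\<lambda>g. \<Sum>i\<in>D. g i) ` ?P = monomial_span M"
    proof
      show "(\<lambda>g. \<Sum>i\<in>D. g i) ` ?P \<subseteq> monomial_span M"
      proof
        fix p assume "p \<in> (\<lambda>g. \<Sum>i\<in>D. g i) ` ?P"
        then obtain g where g: "g \<in> ?P" "p = (\<Sum>i\<in>D. g i)" by blast
        have "t \<in> M" if "t \<in> Poly_Mapping.keys p" for t
        proof -
          have "(\<Sum>i\<in>D. lookup (g i) t) \<noteq> 0"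
            using that by (simp add: g(2) in_keys_iff lookup_sum)
          then obtain i where "i \<in> D" "lookup (g i) t \<noteq> 0"
            by (meson sum.not_neutral_contains_not_neutral)
          then show ?thesis
            using g(1) * by (fastforce simp: monomial_span_def in_keys_iff)
        qed
        then show "p \<in> monomial_span M" by (auto simp: monomial_span_def)
      qed
      show "monomial_span M \<subseteq> (\<lambda>g. \<Sum>i\<in>D. g i) ` ?P"
      proof
        fix p :: "('n, 'k) mpolys" assume p: "p \<in> monomial_span M"
        \<comment> \<open>the restrictions of \<open>p\<close> to the sets \<open>C i\<close>\<close>
        define g where "g = (\<lambda>i\<in>D. \<Sum>t\<in>Poly_Mapping.keys p \<inter> C i.
          Poly_Mapping.single t (lookup p t))"
        have lookup_g: "lookup (g i) t = (if t \<in> C i then lookup p t else 0)" if "i \<in> D" for i t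
          using that
          by (auto simp: g_def lookup_sum lookup_single when_def in_keys_iff)
        have g: "g \<in> ?P"
          using lookup_g by (auto simp: monomial_span_def in_keys_iff g_def split: if_splits)
        have "lookup p t = lookup (\<Sum>i\<in>D. g i) t" for t
        proof (cases "t \<in> M")
          case True
          then obtain i where "i \<in> D" "t \<in> C i" using * by blast
          then show ?thesis by (simp add: sum_lookup[OF g] lookup_g)
        next
          case False
          then have "lookup p t = 0" using p by (auto simp: monomial_span_def in_keys_iff)
          moreover have "(\<Sum>i\<in>D. lookup (g i) t) = 0"
            using False * by (intro sum.neutral) (auto simp: lookup_g)
          ultimately show ?thesis by (simp add: lookup_sum)
        qed
        then have "p = (\<Sum>i\<in>D. g i)" by (rule poly_mapping_eqI)
        then show "p \<in> (\<lambda>g. \<Sum>i\<in>D. g i) ` ?P" using g by blast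
      qed
    qed
  qed
qed

text \<open>
  Stanley decompositions become a purely combinatorial notion. The requirement that the apex of
  each Stanley space lie in the ideal is absorbed by the union, as a cone contains its apex.
\<close>

lemma stanley_decomposition_monomial_span_iff:
  "stanley_decomposition (monomial_span M :: ('n, 'k::field) mpolys set) D \<longleftrightarrow>
    finite D \<and> disjoint_family_on (\<lambda>(u, Z). cone u Z) D \<and> (\<Union>(u, Z)\<in>D. cone u Z) = M"
proof -
  have spaces: "(\<lambda>(u, Z). stanley_space u Z :: ('n, 'k) mpolys set)
      = (\<lambda>i. monomial_span ((\<lambda>(u, Z). cone u Z) i))"
    by (auto simp: stanley_space_eq_monomial_span)
  have apex: "u \<in> cone u Z" for u :: "'n \<Rightarrow>\<^sub>0 nat" and Z
    by (simp add: cone_def)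
  show ?thesis
    unfolding stanley_decomposition_def spaces
    using apex by (auto simp: is_direct_sum_monomial_span_iff mon_in_monomial_span)
qed

section \<open>Partitions of sets of exponents into cones\<close>

definition splits_into_cones :: "nat \<Rightarrow> ('n \<Rightarrow>\<^sub>0 nat) set \<Rightarrow> bool" where
  "splits_into_cones d M \<longleftrightarrow>
    (\<exists>D. finite D \<and> (\<forall>(u, Z)\<in>D. d \<le> card Z) \<and>
      disjoint_family_on (\<lambda>(u, Z). cone u Z) D \<and> (\<Union>(u, Z)\<in>D. cone u Z) = M)"

lemma splits_into_cones_cone: "d \<le> card Z \<Longrightarrow> splits_into_cones d (cone u Z)"
  unfolding splits_into_cones_def
  by (intro exI[of _ "{(u, Z)}"]) (simp add: disjoint_family_on_def)

lemma splits_into_cones_empty: "splits_into_cones d {}"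
  unfolding splits_into_cones_def
  by (intro exI[of _ "{}"]) (simp add: disjoint_family_on_def)

lemma splits_into_cones_Un:
  assumes "splits_into_cones d M" "splits_into_cones d N" "M \<inter> N = {}"
  shows "splits_into_cones d (M \<union> N)"
proof -
  let ?C = "\<lambda>(u, Z). cone u Z"
  obtain D E where D: "finite D" "\<forall>(u, Z)\<in>D. d \<le> card Z" "disjoint_family_on ?C D" "\<Union>(?C ` D) = M"
    and E: "finite E" "\<forall>(u, Z)\<in>E. d \<le> card Z" "disjoint_family_on ?C E" "\<Union>(?C ` E) = N"
    using assms(1,2) unfolding splits_into_cones_def by blast
  have cross: "?C x \<inter> ?C y = {}" if "x \<in> D" "y \<in> E" for x y
    using that D(4) E(4) assms(3) by blast
  have "disjoint_family_on ?C (D \<union> E)"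
    unfolding disjoint_family_on_def
  proof (intro ballI impI)
    fix x y assume "x \<in> D \<union> E" "y \<in> D \<union> E" "x \<noteq> y"
    then show "?C x \<inter> ?C y = {}"
      using cross[of x y] cross[of y x] disjoint_family_onD[OF D(3)] disjoint_family_onD[OF E(3)]
      by blast
  qed
  moreover have "\<Union>(?C ` (D \<union> E)) = M \<union> N" using D(4) E(4) by blast
  moreover have "finite (D \<union> E)" "\<forall>(u, Z)\<in>D \<union> E. d \<le> card Z" using D E by blast+
  ultimately show ?thesis unfolding splits_into_cones_def by blast
qed

lemma splits_into_cones_UN:
  assumes "finite K" "disjoint_family_on M K" "\<And>k. k \<in> K \<Longrightarrow> splits_into_cones d (M k)"
  shows "splits_into_cones d (\<Union>k\<in>K. M k)"
  using assms
proof (induction K)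
  case empty
  then show ?case by (simp add: splits_into_cones_empty)
next
  case (insert k K)
  have "disjoint_family_on M K"
    using insert.prems(1) by (rule disjoint_family_on_mono[rotated]) blast
  moreover have "M k \<inter> (\<Union>k\<in>K. M k) = {}"
    using insert.hyps insert.prems(1) by (fastforce simp: disjoint_family_on_def)
  ultimately show ?case
    using insert by (simp add: splits_into_cones_Un)
qed

lemma splits_into_cones_multiples:
  fixes w :: "'n::finite \<Rightarrow> nat"
  shows "splits_into_cones (CARD('n) - 1) {t. w \<le> lookup t}"
  using splits_into_cones_cone[of "CARD('n) - 1" UNIV "Abs_poly_mapping w"]
  by (simp add: cone_UNIV)

lemma splits_into_cones_slice:
  fixes w :: "'n::finite \<Rightarrow> nat"
  assumes "w j \<le> k"
  shows "splits_into_cones (CARD('n) - 1) {t. w \<le> lookup t \<and> lookup t j = k}"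
proof -
  have "{t. w \<le> lookup t \<and> lookup t j = k} = cone (Abs_poly_mapping (w(j := k))) (UNIV - {j})"
    using assms by (auto simp: cone_def le_fun_def)
  then show ?thesis
    by (simp add: splits_into_cones_cone card_Diff_singleton)
qed

text \<open>
  The induction treats the variables of \<open>F\<close> one at a time. For a new variable \<open>j\<close>, either the
  exponent of \<open>j\<close> is below \<open>u j\<close>, which leaves finitely many values and so finitely many slices of
  dimension \<open>n - 1\<close>; or it is at least \<open>u j\<close>, a condition that can be moved into the lower bound \<open>w\<close>,
  and the failure must occur in the remaining variables. This is why \<open>w\<close> has to vary in the
  induction.
\<close>

lemma splits_into_cones_not_all_above:
  fixes w u :: "'n::finite \<Rightarrow> nat"
  assumes "finite F"
  shows "splits_into_cones (CARD('n) - 1) {t. w \<le> lookup t \<and> \<not> (\<forall>i\<in>F. u i \<le> lookup t i)}"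
  using assms
proof (induction F arbitrary: w)
  case empty
  then show ?case by (simp add: splits_into_cones_empty)
next
  case (insert j F)
  let ?w = "w(j := max (w j) (u j))"
  let ?slice = "\<lambda>k. {t. w \<le> lookup t \<and> lookup t j = k}"
  let ?rest = "{t. ?w \<le> lookup t \<and> \<not> (\<forall>i\<in>F. u i \<le> lookup t i)}"
  have above: "?w \<le> lookup t \<longleftrightarrow> w \<le> lookup t \<and> u j \<le> lookup t j" for t
    by (auto simp: le_fun_def)
  have "{t. w \<le> lookup t \<and> \<not> (\<forall>i\<in>insert j F. u i \<le> lookup t i)}
      = (\<Union>k\<in>{w j..<u j}. ?slice k) \<union> ?rest"
    unfolding above by (auto simp: le_fun_def)
  moreover have "splits_into_cones (CARD('n) - 1) (\<Union>k\<in>{w j..<u j}. ?slice k)"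
    by (rule splits_into_cones_UN) (auto simp: disjoint_family_on_def splits_into_cones_slice simp del: One_nat_def)
  moreover have "(\<Union>k\<in>{w j..<u j}. ?slice k) \<inter> ?rest = {}"
    unfolding above by auto
  ultimately show ?case
    by (simp only: splits_into_cones_Un insert.IH)
qed

lemma splits_into_cones_diff:
  fixes w u :: "'n::finite \<Rightarrow> nat"
  shows "splits_into_cones (CARD('n) - 1) {t. w \<le> lookup t \<and> \<not> u \<le> lookup t}"
  using splits_into_cones_not_all_above[of UNIV w u] by (simp add: le_fun_def)

text \<open>
  The cyclic pattern \<open>a \<and> \<not> c\<close>, \<open>b \<and> \<not> a\<close>, \<open>c \<and> \<not> b\<close> is what makes the three differences
  disjoint. The obvious order \<open>a\<close>, \<open>b \<and> \<not> a\<close>, \<open>c \<and> \<not> a \<and> \<not> b\<close> has a last class that avoids two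
  generators at once, and such a class can force smaller dimensions: avoiding both \<open>x\<close> and \<open>y\<close>
  already fixes two exponents.
\<close>

lemma splits_into_cones_three_generated:
  fixes a b c :: "'n::finite \<Rightarrow> nat"
  shows "splits_into_cones (CARD('n) - 1)
    {t. a \<le> lookup t \<or> b \<le> lookup t \<or> c \<le> lookup t}"
proof -
  let ?d = "\<lambda>w u. {t. w \<le> lookup t \<and> \<not> u \<le> lookup t}"
  have "{t. a \<le> lookup t \<or> b \<le> lookup t \<or> c \<le> lookup t}
      = ((?d a c \<union> ?d b a) \<union> ?d c b) \<union> {t. sup a (sup b c) \<le> lookup t}"
    by auto
  moreover have "splits_into_cones (CARD('n) - 1) \<dots>"
    by (intro splits_into_cones_Un splits_into_cones_diff splits_into_cones_multiples) auto
  ultimately show ?thesis by simp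
qed

section \<open>Stanley depth\<close>

text \<open>Cones of full dimension with apices \<open>u\<close> and \<open>u'\<close> always meet, for instance in \<open>u + u'\<close>.\<close>

lemma principal_ideal_if_full_dimensional:
  fixes I :: "('n::finite, 'k::field) mpolys set"
  assumes I: "I = monomial_span M"
    and D: "stanley_decomposition I D" "D \<noteq> {}" and full: "CARD('n) \<le> sdepth_decomp D"
  shows "principal_ideal I"
proof -
  have fin: "finite D" and disj: "disjoint_family_on (\<lambda>(u, Z). cone u Z) D"
    and M: "(\<Union>(u, Z)\<in>D. cone u Z) = M"
    using D(1) by (auto simp: I stanley_decomposition_monomial_span_iff)
  have UNIV: "Z = UNIV" if "(u, Z) \<in> D" for u Z
  proof -
    have "sdepth_decomp D \<le> card Z"
      unfolding sdepth_decomp_def using fin that by (intro Min_le) force+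
    then show ?thesis
      using full card_mono[of UNIV Z] by (intro card_subset_eq) auto
  qed
  obtain u where u: "(u, UNIV) \<in> D" using D(2) UNIV by fastforce
  have "x = (u, UNIV)" if x: "x \<in> D" for x
  proof -
    obtain u' where x': "x = (u', UNIV)" using UNIV x by (cases x) auto
    have "u + u' \<in> cone u UNIV \<inter> cone u' UNIV"
      by (simp add: cone_UNIV le_fun_def lookup_add)
    then show ?thesis
      using disjoint_family_onD[OF disj x u] x' by auto
  qed
  then have "D = {(u, UNIV)}" using u by blast
  then have "M = {t. \<exists>g\<in>{u}. lookup g \<le> lookup t}" using M by (simp add: cone_UNIV)
  then have "I = ideal_gen {mon u}"
    using I ideal_gen_mon_image[of "{u}", where 'k = 'k] by simp
  then show ?thesis unfolding principal_ideal_def by blast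
qed

text \<open>
  The depths of decompositions lie between \<open>0\<close> and \<open>n\<close>, so the maximum in the Stanley depth is
  attained and can be bounded from both sides. Decompositions are nonempty because the ideal
  contains its generators, so that the minimum over the summands is meaningful too.
\<close>

lemma sdepth_three_generated:
  fixes a b c :: "'n::finite \<Rightarrow>\<^sub>0 nat"
    and I :: "('n, 'k::field) mpolys set"
  assumes "I = ideal_gen {mon a, mon b, mon c}"
  shows "CARD('n) - 1 \<le> sdepth I"
    and "\<not> principal_ideal I \<Longrightarrow> sdepth I = CARD('n) - 1"
proof -
  define M where "M = {t. lookup a \<le> lookup t \<or> lookup b \<le> lookup t \<or> lookup c \<le> lookup t}"
  have I: "I = monomial_span M"
    using assms ideal_gen_mon_image[of "{a, b, c}", where 'k = 'k] by (simp add: M_def)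
  have nonempty: "D \<noteq> {}" if "stanley_decomposition I D" for D
    using that by (auto simp: I stanley_decomposition_monomial_span_iff M_def)
  let ?S = "{sdepth_decomp D | D. stanley_decomposition I D}"
  have le: "sdepth_decomp D \<le> CARD('n)" if D: "stanley_decomposition I D" for D
  proof -
    obtain u Z where uZ: "(u, Z) \<in> D" using nonempty[OF D] by fastforce
    have "sdepth_decomp D \<le> card Z"
      unfolding sdepth_decomp_def using D uZ
      by (intro Min_le) (force simp: stanley_decomposition_def)+
    also have "\<dots> \<le> CARD('n)" by (rule card_mono) auto
    finally show ?thesis .
  qed
  then have fin: "finite ?S"
    by (intro finite_subset[of ?S "{..CARD('n)}"]) auto
  obtain D where D: "stanley_decomposition I D" and dim: "\<forall>(u, Z)\<in>D. CARD('n) - 1 \<le> card Z"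
    using splits_into_cones_three_generated[of "lookup a" "lookup b" "lookup c"]
    unfolding splits_into_cones_def I stanley_decomposition_monomial_span_iff M_def by blast
  have "CARD('n) - 1 \<le> sdepth_decomp D"
    unfolding sdepth_decomp_def using nonempty[OF D] D dim
    by (subst Min_ge_iff) (auto simp: stanley_decomposition_def)
  also have "\<dots> \<le> sdepth I"
    unfolding sdepth_def using fin D by (intro Max_ge) auto
  finally show lower: "CARD('n) - 1 \<le> sdepth I" .
  assume "\<not> principal_ideal I"
  then have "sdepth_decomp E \<le> CARD('n) - 1" if "stanley_decomposition I E" for E
    using principal_ideal_if_full_dimensional[OF I that nonempty[OF that]] by linarith
  then have "sdepth I \<le> CARD('n) - 1"
    unfolding sdepth_def using fin D by (subst Max_le_iff) auto
  then show "sdepth I = CARD('n) - 1" using lower by simp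
qed

theorem theorem4p1:
  fixes v1 v2 v3 :: "('n::finite, 'k::field) mpolys"
    and I :: "('n, 'k) mpolys set"
  assumes "squarefree_monomial v1" "squarefree_monomial v2" "squarefree_monomial v3"
    and "I = ideal_gen {v1, v2, v3}"
  shows "sdepth I \<ge> CARD('n) - 1 \<and> (\<not> principal_ideal I \<longrightarrow> sdepth I = CARD('n) - 1)"
proof -
  obtain a b c where "v1 = mon a" "v2 = mon b" "v3 = mon c"
    using assms(1-3) unfolding squarefree_monomial_def by blast
  with assms(4) have "I = ideal_gen {mon a, mon b, mon c}" by simp
  from sdepth_three_generated[OF this] show ?thesis by blast
qed

end
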